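(* Let $\mathcal V$ be a monoidal model category with cofibrant unit $I$, and suppose that there are a $\mathcal V$-functor $Q\colon\mathcal V\to\mathcal V$ and a $\mathcal V$-natural transformation $q\colon Q\to 1$ exhibiting $Q$ as a cofibrant replacement $\mathcal V$-functor. Then all objects of $\mathcal V$ are cofibrant.
   Context: Monoidal model category: a closed symmetric monoidal category $\mathcal V$ with a model structure satisfying the pushout-product axiom. $\mathcal V$ is regarded as enriched in itself via its internal hom. That $q\colon Q\to 1$ exhibits $Q$ as a cofibrant replacement means that for every object $X$ the object $QX$ is cofibrant and $q_X\colon QX\to X$ is a trivial fibration. *)

theory Defs
  imports Main
begin

unbundle cardinal_syntax

section \<open>Categories\<close>

record ('o, 'm) cat =
  Obj :: "'o set"
  Arr :: "'m set"
  Dom :: "'m \<Rightarrow> 'o"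
  Cod :: "'m \<Rightarrow> 'o"
  Idt :: "'o \<Rightarrow> 'm" ("\<one>\<index>")
  Comp :: "'m \<Rightarrow> 'm \<Rightarrow> 'm" (infixr "\<cdot>\<index>" 55)

definition hom :: "('o, 'm, 'z) cat_scheme \<Rightarrow> 'o \<Rightarrow> 'o \<Rightarrow> 'm set" where
  "hom C X Y = {f \<in> Arr C. Dom C f = X \<and> Cod C f = Y}"

locale category =
  fixes C :: "('o, 'm, 'z) cat_scheme" (structure)
  assumes Dom_Obj: "f \<in> Arr C \<Longrightarrow> Dom C f \<in> Obj C"
    and Cod_Obj: "f \<in> Arr C \<Longrightarrow> Cod C f \<in> Obj C"
    and Idt_hom: "X \<in> Obj C \<Longrightarrow> \<one> X \<in> hom C X X"
    and Comp_hom: "\<lbrakk>f \<in> hom C X Y; g \<in> hom C Y Z\<rbrakk> \<Longrightarrow> g \<cdot> f \<in> hom C X Z"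
    and Comp_Idt_right: "f \<in> hom C X Y \<Longrightarrow> f \<cdot> \<one> X = f"
    and Comp_Idt_left: "f \<in> hom C X Y \<Longrightarrow> \<one> Y \<cdot> f = f"
    and Comp_assoc: "\<lbrakk>f \<in> hom C W X; g \<in> hom C X Y; h \<in> hom C Y Z\<rbrakk>
      \<Longrightarrow> (h \<cdot> g) \<cdot> f = h \<cdot> (g \<cdot> f)"

definition are_inverse :: "('o, 'm, 'z) cat_scheme \<Rightarrow> 'm \<Rightarrow> 'm \<Rightarrow> bool" where
  "are_inverse C f g \<longleftrightarrow> f \<in> Arr C \<and> g \<in> hom C (Cod C f) (Dom C f)
     \<and> g \<cdot>\<^bsub>C\<^esub> f = \<one>\<^bsub>C\<^esub> (Dom C f) \<and> f \<cdot>\<^bsub>C\<^esub> g = \<one>\<^bsub>C\<^esub> (Cod C f)"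

definition iso_arr :: "('o, 'm, 'z) cat_scheme \<Rightarrow> 'm \<Rightarrow> bool" where
  "iso_arr C f \<longleftrightarrow> (\<exists>g. are_inverse C f g)"

definition inv_arr :: "('o, 'm, 'z) cat_scheme \<Rightarrow> 'm \<Rightarrow> 'm" where
  "inv_arr C f = (THE g. are_inverse C f g)"

section \<open>Limits and colimits\<close>

definition is_diagram ::
  "('i, 'u, 'y) cat_scheme \<Rightarrow> ('o, 'm, 'z) cat_scheme \<Rightarrow> ('i \<Rightarrow> 'o) \<Rightarrow> ('u \<Rightarrow> 'm) \<Rightarrow> bool" where
  "is_diagram J C Do Da \<longleftrightarrow>
     (\<forall>i \<in> Obj J. Do i \<in> Obj C) \<and>
     (\<forall>i \<in> Obj J. \<forall>j \<in> Obj J. \<forall>u \<in> hom J i j. Da u \<in> hom C (Do i) (Do j)) \<and>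
     (\<forall>i \<in> Obj J. Da (\<one>\<^bsub>J\<^esub> i) = \<one>\<^bsub>C\<^esub> (Do i)) \<and>
     (\<forall>i \<in> Obj J. \<forall>j \<in> Obj J. \<forall>k \<in> Obj J. \<forall>u \<in> hom J i j. \<forall>v \<in> hom J j k.
        Da (v \<cdot>\<^bsub>J\<^esub> u) = Da v \<cdot>\<^bsub>C\<^esub> Da u)"

definition is_cone where
  "is_cone J C Do Da X p \<longleftrightarrow>
     X \<in> Obj C \<and> (\<forall>i \<in> Obj J. p i \<in> hom C X (Do i)) \<and>
     (\<forall>u \<in> Arr J. Da u \<cdot>\<^bsub>C\<^esub> p (Dom J u) = p (Cod J u))"

definition is_limit where
  "is_limit J C Do Da L p \<longleftrightarrow> is_cone J C Do Da L p \<and>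
     (\<forall>X r. is_cone J C Do Da X r \<longrightarrow>
        (\<exists>!h. h \<in> hom C X L \<and> (\<forall>i \<in> Obj J. p i \<cdot>\<^bsub>C\<^esub> h = r i)))"

definition is_cocone where
  "is_cocone J C Do Da X p \<longleftrightarrow>
     X \<in> Obj C \<and> (\<forall>i \<in> Obj J. p i \<in> hom C (Do i) X) \<and>
     (\<forall>u \<in> Arr J. p (Cod J u) \<cdot>\<^bsub>C\<^esub> Da u = p (Dom J u))"

definition is_colimit where
  "is_colimit J C Do Da L p \<longleftrightarrow> is_cocone J C Do Da L p \<and>
     (\<forall>X r. is_cocone J C Do Da X r \<longrightarrow>
        (\<exists>!h. h \<in> hom C L X \<and> (\<forall>i \<in> Obj J. h \<cdot>\<^bsub>C\<^esub> p i = r i)))"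

text \<open>
  The size convention is an infinite cardinal \<open>\<kappa>\<close>: a category is small if it has fewer than
  \<open>\<kappa>\<close> arrows. For \<open>\<kappa>\<close> inaccessible this is smallness relative to a Grothendieck universe;
  for \<open>\<kappa> = natLeq\<close> it is finiteness. A category with fewer than \<open>\<kappa>\<close> arrows has an isomorphic
  copy inside the field of \<open>\<kappa>\<close>, so index categories with objects and arrows of type \<open>'s\<close>
  suffice.
\<close>

locale bicomplete_category = category C for C :: "('o, 'm, 'z) cat_scheme" +
  fixes \<kappa> :: "'s rel"
  assumes size_Card_order: "Card_order \<kappa>"
    and size_infinite: "cinfinite \<kappa>"
    and has_limits: "\<lbrakk>category (J :: ('s, 's) cat); |Arr J| <o \<kappa>; is_diagram J C Do Da\<rbrakk>
      \<Longrightarrow> \<exists>L p. is_limit J C Do Da L p"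
    and has_colimits: "\<lbrakk>category (J :: ('s, 's) cat); |Arr J| <o \<kappa>; is_diagram J C Do Da\<rbrakk>
      \<Longrightarrow> \<exists>L p. is_colimit J C Do Da L p"

definition is_initial :: "('o, 'm, 'z) cat_scheme \<Rightarrow> 'o \<Rightarrow> bool" where
  "is_initial C Z \<longleftrightarrow> Z \<in> Obj C \<and> (\<forall>X \<in> Obj C. \<exists>!f. f \<in> hom C Z X)"

definition is_pushout ::
  "('o, 'm, 'z) cat_scheme \<Rightarrow> 'm \<Rightarrow> 'm \<Rightarrow> 'o \<Rightarrow> 'm \<Rightarrow> 'm \<Rightarrow> bool" where
  "is_pushout C f g P i j \<longleftrightarrow>
     f \<in> Arr C \<and> g \<in> Arr C \<and> Dom C f = Dom C g \<and>
     P \<in> Obj C \<and> i \<in> hom C (Cod C f) P \<and> j \<in> hom C (Cod C g) P \<and>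
     i \<cdot>\<^bsub>C\<^esub> f = j \<cdot>\<^bsub>C\<^esub> g \<and>
     (\<forall>X \<in> Obj C. \<forall>u \<in> hom C (Cod C f) X. \<forall>v \<in> hom C (Cod C g) X.
        u \<cdot>\<^bsub>C\<^esub> f = v \<cdot>\<^bsub>C\<^esub> g \<longrightarrow>
        (\<exists>!h. h \<in> hom C P X \<and> h \<cdot>\<^bsub>C\<^esub> i = u \<and> h \<cdot>\<^bsub>C\<^esub> j = v))"

section \<open>Closed symmetric monoidal categories\<close>

record ('o, 'm) moncat = "('o, 'm) cat" +
  TensO :: "'o \<Rightarrow> 'o \<Rightarrow> 'o" (infixr "\<otimes>\<index>" 70)
  TensA :: "'m \<Rightarrow> 'm \<Rightarrow> 'm" (infixr "\<odot>\<index>" 70)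
  Unit :: "'o" ("\<I>\<index>")
  Assoc :: "'o \<Rightarrow> 'o \<Rightarrow> 'o \<Rightarrow> 'm"
  Lunit :: "'o \<Rightarrow> 'm"
  Runit :: "'o \<Rightarrow> 'm"

locale monoidal_category = category V for V :: "('o, 'm, 'z) moncat_scheme" (structure) +
  assumes Unit_Obj: "\<I> \<in> Obj V"
    and TensO_Obj: "\<lbrakk>X \<in> Obj V; Y \<in> Obj V\<rbrakk> \<Longrightarrow> X \<otimes> Y \<in> Obj V"
    and TensA_hom: "\<lbrakk>f \<in> hom V X X'; g \<in> hom V Y Y'\<rbrakk> \<Longrightarrow> f \<odot> g \<in> hom V (X \<otimes> Y) (X' \<otimes> Y')"
    and TensA_Idt: "\<lbrakk>X \<in> Obj V; Y \<in> Obj V\<rbrakk> \<Longrightarrow> \<one> X \<odot> \<one> Y = \<one> (X \<otimes> Y)"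
    and TensA_Comp:
      "\<lbrakk>f \<in> hom V X X'; f' \<in> hom V X' X''; g \<in> hom V Y Y'; g' \<in> hom V Y' Y''\<rbrakk>
        \<Longrightarrow> (f' \<cdot> f) \<odot> (g' \<cdot> g) = (f' \<odot> g') \<cdot> (f \<odot> g)"
    and Assoc_hom: "\<lbrakk>X \<in> Obj V; Y \<in> Obj V; Z \<in> Obj V\<rbrakk>
        \<Longrightarrow> Assoc V X Y Z \<in> hom V ((X \<otimes> Y) \<otimes> Z) (X \<otimes> (Y \<otimes> Z))"
    and Assoc_iso: "\<lbrakk>X \<in> Obj V; Y \<in> Obj V; Z \<in> Obj V\<rbrakk> \<Longrightarrow> iso_arr V (Assoc V X Y Z)"
    and Assoc_natural: "\<lbrakk>f \<in> hom V X X'; g \<in> hom V Y Y'; h \<in> hom V Z Z'\<rbrakk>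
        \<Longrightarrow> Assoc V X' Y' Z' \<cdot> ((f \<odot> g) \<odot> h) = (f \<odot> (g \<odot> h)) \<cdot> Assoc V X Y Z"
    and Lunit_hom: "X \<in> Obj V \<Longrightarrow> Lunit V X \<in> hom V (\<I> \<otimes> X) X"
    and Lunit_iso: "X \<in> Obj V \<Longrightarrow> iso_arr V (Lunit V X)"
    and Lunit_natural: "f \<in> hom V X Y \<Longrightarrow> Lunit V Y \<cdot> (\<one> \<I> \<odot> f) = f \<cdot> Lunit V X"
    and Runit_hom: "X \<in> Obj V \<Longrightarrow> Runit V X \<in> hom V (X \<otimes> \<I>) X"
    and Runit_iso: "X \<in> Obj V \<Longrightarrow> iso_arr V (Runit V X)"
    and Runit_natural: "f \<in> hom V X Y \<Longrightarrow> Runit V Y \<cdot> (f \<odot> \<one> \<I>) = f \<cdot> Runit V X"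
    and triangle: "\<lbrakk>X \<in> Obj V; Y \<in> Obj V\<rbrakk>
        \<Longrightarrow> (\<one> X \<odot> Lunit V Y) \<cdot> Assoc V X \<I> Y = Runit V X \<odot> \<one> Y"
    and pentagon: "\<lbrakk>W \<in> Obj V; X \<in> Obj V; Y \<in> Obj V; Z \<in> Obj V\<rbrakk>
        \<Longrightarrow> (\<one> W \<odot> Assoc V X Y Z) \<cdot> (Assoc V W (X \<otimes> Y) Z \<cdot> (Assoc V W X Y \<odot> \<one> Z))
          = Assoc V W X (Y \<otimes> Z) \<cdot> Assoc V (W \<otimes> X) Y Z"

record ('o, 'm) csmcat = "('o, 'm) moncat" +
  Braid :: "'o \<Rightarrow> 'o \<Rightarrow> 'm"
  IHom :: "'o \<Rightarrow> 'o \<Rightarrow> 'o"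
  Eval :: "'o \<Rightarrow> 'o \<Rightarrow> 'm"

locale closed_symmetric_monoidal_category =
  monoidal_category V for V :: "('o, 'm, 'z) csmcat_scheme" (structure) +
  assumes Braid_hom: "\<lbrakk>X \<in> Obj V; Y \<in> Obj V\<rbrakk> \<Longrightarrow> Braid V X Y \<in> hom V (X \<otimes> Y) (Y \<otimes> X)"
    and Braid_natural: "\<lbrakk>f \<in> hom V X X'; g \<in> hom V Y Y'\<rbrakk>
        \<Longrightarrow> Braid V X' Y' \<cdot> (f \<odot> g) = (g \<odot> f) \<cdot> Braid V X Y"
    and Braid_symmetric: "\<lbrakk>X \<in> Obj V; Y \<in> Obj V\<rbrakk> \<Longrightarrow> Braid V Y X \<cdot> Braid V X Y = \<one> (X \<otimes> Y)"
    and hexagon: "\<lbrakk>X \<in> Obj V; Y \<in> Obj V; Z \<in> Obj V\<rbrakk>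
        \<Longrightarrow> Assoc V Y Z X \<cdot> (Braid V X (Y \<otimes> Z) \<cdot> Assoc V X Y Z)
          = (\<one> Y \<odot> Braid V X Z) \<cdot> (Assoc V Y X Z \<cdot> (Braid V X Y \<odot> \<one> Z))"
    and IHom_Obj: "\<lbrakk>X \<in> Obj V; Y \<in> Obj V\<rbrakk> \<Longrightarrow> IHom V X Y \<in> Obj V"
    and Eval_hom: "\<lbrakk>X \<in> Obj V; Y \<in> Obj V\<rbrakk> \<Longrightarrow> Eval V X Y \<in> hom V (IHom V X Y \<otimes> X) Y"
    and closed: "\<lbrakk>X \<in> Obj V; Y \<in> Obj V; Z \<in> Obj V; f \<in> hom V (Z \<otimes> X) Y\<rbrakk>
        \<Longrightarrow> \<exists>!g. g \<in> hom V Z (IHom V X Y) \<and> Eval V X Y \<cdot> (g \<odot> \<one> X) = f"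

definition curry_arr :: "('o, 'm, 'z) csmcat_scheme \<Rightarrow> 'o \<Rightarrow> 'o \<Rightarrow> 'o \<Rightarrow> 'm \<Rightarrow> 'm" where
  "curry_arr V Z X Y f =
     (THE g. g \<in> hom V Z (IHom V X Y) \<and> Eval V X Y \<cdot>\<^bsub>V\<^esub> (g \<odot>\<^bsub>V\<^esub> \<one>\<^bsub>V\<^esub> X) = f)"

section \<open>Model structures\<close>

record 'm model_structure =
  Weq :: "'m set"
  Cof :: "'m set"
  Fib :: "'m set"

definition is_retract :: "('o, 'm, 'z) cat_scheme \<Rightarrow> 'm \<Rightarrow> 'm \<Rightarrow> bool" where
  "is_retract C f g \<longleftrightarrow> f \<in> Arr C \<and> g \<in> Arr C \<and>
     (\<exists>s \<in> hom C (Dom C f) (Dom C g). \<exists>r \<in> hom C (Dom C g) (Dom C f).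
      \<exists>s' \<in> hom C (Cod C f) (Cod C g). \<exists>r' \<in> hom C (Cod C g) (Cod C f).
        r \<cdot>\<^bsub>C\<^esub> s = \<one>\<^bsub>C\<^esub> (Dom C f) \<and> r' \<cdot>\<^bsub>C\<^esub> s' = \<one>\<^bsub>C\<^esub> (Cod C f) \<and>
        g \<cdot>\<^bsub>C\<^esub> s = s' \<cdot>\<^bsub>C\<^esub> f \<and> f \<cdot>\<^bsub>C\<^esub> r = r' \<cdot>\<^bsub>C\<^esub> g)"

definition has_lifting :: "('o, 'm, 'z) cat_scheme \<Rightarrow> 'm \<Rightarrow> 'm \<Rightarrow> bool" where
  "has_lifting C i p \<longleftrightarrow>
     (\<forall>u \<in> hom C (Dom C i) (Dom C p). \<forall>v \<in> hom C (Cod C i) (Cod C p).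
        p \<cdot>\<^bsub>C\<^esub> u = v \<cdot>\<^bsub>C\<^esub> i \<longrightarrow>
        (\<exists>h \<in> hom C (Cod C i) (Dom C p). h \<cdot>\<^bsub>C\<^esub> i = u \<and> p \<cdot>\<^bsub>C\<^esub> h = v))"

locale model_category = bicomplete_category C \<kappa>
  for C :: "('o, 'm, 'z) cat_scheme" (structure) and \<kappa> :: "'s rel" +
  fixes M :: "'m model_structure"
  assumes Weq_Arr: "Weq M \<subseteq> Arr C"
    and Cof_Arr: "Cof M \<subseteq> Arr C"
    and Fib_Arr: "Fib M \<subseteq> Arr C"
    and Weq_comp: "\<lbrakk>f \<in> hom C X Y; g \<in> hom C Y Z; f \<in> Weq M; g \<in> Weq M\<rbrakk>
        \<Longrightarrow> g \<cdot> f \<in> Weq M"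
    and Weq_left: "\<lbrakk>f \<in> hom C X Y; g \<in> hom C Y Z; f \<in> Weq M; g \<cdot> f \<in> Weq M\<rbrakk> \<Longrightarrow> g \<in> Weq M"
    and Weq_right: "\<lbrakk>f \<in> hom C X Y; g \<in> hom C Y Z; g \<in> Weq M; g \<cdot> f \<in> Weq M\<rbrakk> \<Longrightarrow> f \<in> Weq M"
    and Weq_retract: "\<lbrakk>is_retract C f g; g \<in> Weq M\<rbrakk> \<Longrightarrow> f \<in> Weq M"
    and Cof_retract: "\<lbrakk>is_retract C f g; g \<in> Cof M\<rbrakk> \<Longrightarrow> f \<in> Cof M"
    and Fib_retract: "\<lbrakk>is_retract C f g; g \<in> Fib M\<rbrakk> \<Longrightarrow> f \<in> Fib M"
    and lifting_Cof: "\<lbrakk>i \<in> Cof M; p \<in> Fib M \<inter> Weq M\<rbrakk> \<Longrightarrow> has_lifting C i p"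
    and lifting_trivial_Cof: "\<lbrakk>i \<in> Cof M \<inter> Weq M; p \<in> Fib M\<rbrakk> \<Longrightarrow> has_lifting C i p"
    and factor_Cof: "f \<in> Arr C \<Longrightarrow>
        \<exists>i \<in> Cof M. \<exists>p \<in> Fib M \<inter> Weq M. Cod C i = Dom C p \<and> f = p \<cdot> i"
    and factor_Fib: "f \<in> Arr C \<Longrightarrow>
        \<exists>i \<in> Cof M \<inter> Weq M. \<exists>p \<in> Fib M. Cod C i = Dom C p \<and> f = p \<cdot> i"

definition cofibrant :: "('o, 'm, 'z) cat_scheme \<Rightarrow> 'm model_structure \<Rightarrow> 'o \<Rightarrow> bool" where
  "cofibrant C M X \<longleftrightarrow> X \<in> Obj C \<and> (\<exists>Z. is_initial C Z \<and> (\<exists>i \<in> hom C Z X. i \<in> Cof M))"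

text \<open>
  In the pushout-product axiom, for \<open>f : A \<rightarrow> B\<close> and \<open>g : K \<rightarrow> L\<close>, the arrow \<open>h\<close> is the
  comparison \<open>(A \<otimes> L) +\<^bsub>A \<otimes> K\<^esub> (B \<otimes> K) \<rightarrow> B \<otimes> L\<close>.
\<close>

locale monoidal_model_category =
  closed_symmetric_monoidal_category V + model_category V \<kappa> M
  for V :: "('o, 'm, 'z) csmcat_scheme" (structure)
    and \<kappa> :: "'s rel" and M :: "'m model_structure" +
  assumes pushout_product:
    "\<lbrakk>f \<in> hom V A B; g \<in> hom V K L; f \<in> Cof M; g \<in> Cof M;
      is_pushout V (\<one> A \<odot> g) (f \<odot> \<one> K) P i j;
      h \<in> hom V P (B \<otimes> L); h \<cdot> i = f \<odot> \<one> L; h \<cdot> j = \<one> B \<odot> g\<rbrakk>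
     \<Longrightarrow> h \<in> Cof M \<and> (f \<in> Weq M \<or> g \<in> Weq M \<longrightarrow> h \<in> Weq M)"

section \<open>Enriched categories\<close>

record ('a, 'o, 'm) ecat =
  EObj :: "'a set"
  EHom :: "'a \<Rightarrow> 'a \<Rightarrow> 'o"
  EIdt :: "'a \<Rightarrow> 'm"
  EComp :: "'a \<Rightarrow> 'a \<Rightarrow> 'a \<Rightarrow> 'm"

locale enriched_category = monoidal_category V
  for V :: "('o, 'm, 'z) moncat_scheme" (structure) +
  fixes A :: "('a, 'o, 'm) ecat"
  assumes EHom_Obj: "\<lbrakk>X \<in> EObj A; Y \<in> EObj A\<rbrakk> \<Longrightarrow> EHom A X Y \<in> Obj V"
    and EIdt_hom: "X \<in> EObj A \<Longrightarrow> EIdt A X \<in> hom V \<I> (EHom A X X)"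
    and EComp_hom: "\<lbrakk>X \<in> EObj A; Y \<in> EObj A; Z \<in> EObj A\<rbrakk>
        \<Longrightarrow> EComp A X Y Z \<in> hom V (EHom A Y Z \<otimes> EHom A X Y) (EHom A X Z)"
    and EComp_assoc: "\<lbrakk>W \<in> EObj A; X \<in> EObj A; Y \<in> EObj A; Z \<in> EObj A\<rbrakk>
        \<Longrightarrow> EComp A W X Z \<cdot> (EComp A X Y Z \<odot> \<one> (EHom A W X))
          = EComp A W Y Z \<cdot> ((\<one> (EHom A Y Z) \<odot> EComp A W X Y)
              \<cdot> Assoc V (EHom A Y Z) (EHom A X Y) (EHom A W X))"
    and EComp_EIdt_left: "\<lbrakk>X \<in> EObj A; Y \<in> EObj A\<rbrakk>
        \<Longrightarrow> EComp A X Y Y \<cdot> (EIdt A Y \<odot> \<one> (EHom A X Y)) = Lunit V (EHom A X Y)"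
    and EComp_EIdt_right: "\<lbrakk>X \<in> EObj A; Y \<in> EObj A\<rbrakk>
        \<Longrightarrow> EComp A X X Y \<cdot> (\<one> (EHom A X Y) \<odot> EIdt A X) = Runit V (EHom A X Y)"

locale enriched_functor = A: enriched_category V A + B: enriched_category V B
  for V :: "('o, 'm, 'z) moncat_scheme" (structure)
    and A :: "('a, 'o, 'm) ecat" and B :: "('b, 'o, 'm) ecat" +
  fixes Fo :: "'a \<Rightarrow> 'b" and Fh :: "'a \<Rightarrow> 'a \<Rightarrow> 'm"
  assumes Fo_EObj: "X \<in> EObj A \<Longrightarrow> Fo X \<in> EObj B"
    and Fh_hom: "\<lbrakk>X \<in> EObj A; Y \<in> EObj A\<rbrakk>
        \<Longrightarrow> Fh X Y \<in> hom V (EHom A X Y) (EHom B (Fo X) (Fo Y))"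
    and Fh_EIdt: "X \<in> EObj A \<Longrightarrow> Fh X X \<cdot> EIdt A X = EIdt B (Fo X)"
    and Fh_EComp: "\<lbrakk>X \<in> EObj A; Y \<in> EObj A; Z \<in> EObj A\<rbrakk>
        \<Longrightarrow> Fh X Z \<cdot> EComp A X Y Z
          = EComp B (Fo X) (Fo Y) (Fo Z) \<cdot> (Fh Y Z \<odot> Fh X Y)"

locale enriched_natural_transformation =
  F: enriched_functor V A B Fo Fh + G: enriched_functor V A B Go Gh
  for V :: "('o, 'm, 'z) moncat_scheme" (structure)
    and A :: "('a, 'o, 'm) ecat" and B :: "('b, 'o, 'm) ecat"
    and Fo :: "'a \<Rightarrow> 'b" and Fh :: "'a \<Rightarrow> 'a \<Rightarrow> 'm"
    and Go :: "'a \<Rightarrow> 'b" and Gh :: "'a \<Rightarrow> 'a \<Rightarrow> 'm" +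
  fixes t :: "'a \<Rightarrow> 'm"
  assumes component_hom: "X \<in> EObj A \<Longrightarrow> t X \<in> hom V \<I> (EHom B (Fo X) (Go X))"
    and natural: "\<lbrakk>X \<in> EObj A; Y \<in> EObj A\<rbrakk>
        \<Longrightarrow> EComp B (Fo X) (Fo Y) (Go Y) \<cdot> ((t Y \<odot> Fh X Y) \<cdot> inv_arr V (Lunit V (EHom A X Y)))
          = EComp B (Fo X) (Go X) (Go Y) \<cdot> ((Gh X Y \<odot> t X) \<cdot> inv_arr V (Runit V (EHom A X Y)))"

definition self_enriched :: "('o, 'm, 'z) csmcat_scheme \<Rightarrow> ('o, 'o, 'm) ecat" where
  "self_enriched V = \<lparr>
     EObj = Obj V,
     EHom = IHom V,
     EIdt = (\<lambda>X. curry_arr V \<I>\<^bsub>V\<^esub> X X (Lunit V X)),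
     EComp = (\<lambda>X Y Z. curry_arr V (IHom V Y Z \<otimes>\<^bsub>V\<^esub> IHom V X Y) X Z
       (Eval V Y Z \<cdot>\<^bsub>V\<^esub> ((\<one>\<^bsub>V\<^esub> (IHom V Y Z) \<odot>\<^bsub>V\<^esub> Eval V X Y)
          \<cdot>\<^bsub>V\<^esub> Assoc V (IHom V Y Z) (IHom V X Y) X)))\<rparr>"

definition underlying_arr :: "('o, 'm, 'z) csmcat_scheme \<Rightarrow> 'o \<Rightarrow> 'o \<Rightarrow> 'm \<Rightarrow> 'm" where
  "underlying_arr V X Y a =
     Eval V X Y \<cdot>\<^bsub>V\<^esub> ((a \<odot>\<^bsub>V\<^esub> \<one>\<^bsub>V\<^esub> X) \<cdot>\<^bsub>V\<^esub> inv_arr V (Lunit V X))"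

unbundle no cardinal_syntax


end

theory Submission
  imports Defs
begin

text \<open>
  Every object \<open>X\<close> is a retract of the cofibrant object \<open>Q X\<close>. Since the unit \<open>I\<close> is cofibrant and
  \<open>q\<^sub>I : Q I \<rightarrow> I\<close> is a trivial fibration, \<open>q\<^sub>I\<close> has a section \<open>s : I \<rightarrow> Q I\<close>. The enrichment of \<open>Q\<close>
  spreads this one section over all objects: for each \<open>X\<close> take the composite
  \<open>X \<cong> [I, X] \<rightarrow> [Q I, Q X] \<rightarrow> [I, Q X] \<cong> Q X\<close>,
  whose middle arrows are the action of \<open>Q\<close> and restriction along \<open>s\<close>. Enriched naturality of \<open>q\<close>
  turns \<open>q\<^sub>X\<close> after this composite into restriction along \<open>q\<^sub>I \<cdot> s = 1\<close>, so the composite is a section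
  of \<open>q\<^sub>X\<close>. An ordinary functor would give no such arrow, because there need not be enough arrows
  \<open>I \<rightarrow> X\<close> to detect \<open>X\<close>.

  The calculation is carried out with uncurried arrows. Enriched naturality then becomes an equation
  between arrows \<open>[X, Y] \<otimes> Q X \<rightarrow> Y\<close> (\<open>uncurried_naturality\<close>); the section is built from it in
  \<open>section_from_unit\<close>. The only coherence needed beyond the monoidal axioms is the compatibility of
  the left unit constraint with associativity, \<open>Lunit_TensO\<close>.
\<close>

section \<open>Composition and inverses\<close>

context category
begin

lemma homI: "\<lbrakk>f \<in> Arr C; Dom C f = X; Cod C f = Y\<rbrakk> \<Longrightarrow> f \<in> hom C X Y"
  by (simp add: hom_def)

lemma homD:
  assumes "f \<in> hom C X Y"
  shows "f \<in> Arr C" "Dom C f = X" "Cod C f = Y"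
  using assms by (simp_all add: hom_def)

lemma hom_Obj:
  assumes "f \<in> hom C X Y"
  shows "X \<in> Obj C" "Y \<in> Obj C"
  using assms Dom_Obj Cod_Obj by (auto simp: hom_def)

text \<open>
  Typing by \<open>Arr\<close>, \<open>Dom\<close> and \<open>Cod\<close> instead of \<open>hom\<close> makes the side conditions of composition free
  of schematic objects, so that the simplifier can discharge them.
\<close>

lemma Idt_typing [simp]:
  assumes "X \<in> Obj C"
  shows "\<one> X \<in> Arr C" "Dom C (\<one> X) = X" "Cod C (\<one> X) = X"
  using homD[OF Idt_hom[OF assms]] by simp_all

lemma Comp_typing [simp]:
  assumes "f \<in> Arr C" "g \<in> Arr C" "Cod C f = Dom C g"
  shows "g \<cdot> f \<in> Arr C" "Dom C (g \<cdot> f) = Dom C f" "Cod C (g \<cdot> f) = Cod C g"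
proof -
  have "g \<cdot> f \<in> hom C (Dom C f) (Cod C g)"
    using Comp_hom[OF homI homI] assms by simp
  then show "g \<cdot> f \<in> Arr C" "Dom C (g \<cdot> f) = Dom C f" "Cod C (g \<cdot> f) = Cod C g"
    by (simp_all add: hom_def)
qed

lemma Comp_Idt [simp]:
  assumes "f \<in> Arr C"
  shows "Dom C f = X \<Longrightarrow> f \<cdot> \<one> X = f" "Cod C f = X \<Longrightarrow> \<one> X \<cdot> f = f"
  using assms Comp_Idt_right Comp_Idt_left by (auto simp: hom_def)

lemma Comp_assoc_Arr [simp]:
  assumes "f \<in> Arr C" "g \<in> Arr C" "h \<in> Arr C" "Cod C f = Dom C g" "Cod C g = Dom C h"
  shows "(h \<cdot> g) \<cdot> f = h \<cdot> (g \<cdot> f)"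
  using assms by (intro Comp_assoc[OF homI homI homI]) simp_all

lemma inv_arr_are_inverse:
  assumes "iso_arr C f"
  shows "are_inverse C f (inv_arr C f)"
proof -
  obtain g where g: "are_inverse C f g" using assms by (auto simp: iso_arr_def)
  have "g' = g" if g': "are_inverse C f g'" for g'
  proof -
    have "(g' \<cdot> f) \<cdot> g = g' \<cdot> (f \<cdot> g)"
      using g g' by (intro Comp_assoc_Arr) (simp_all add: are_inverse_def hom_def)
    then show ?thesis using g g' by (simp add: are_inverse_def hom_def)
  qed
  then show ?thesis unfolding inv_arr_def using g by (rule theI[where P = "are_inverse C f", rotated])
qed

lemma inv_arr_typing:
  assumes "iso_arr C f"
  shows "inv_arr C f \<in> Arr C" "Dom C (inv_arr C f) = Cod C f" "Cod C (inv_arr C f) = Dom C f"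
  using inv_arr_are_inverse[OF assms] by (simp_all add: are_inverse_def hom_def)

lemma inv_arr_Comp:
  assumes "iso_arr C f"
  shows "inv_arr C f \<cdot> f = \<one> (Dom C f)" "f \<cdot> inv_arr C f = \<one> (Cod C f)"
  using inv_arr_are_inverse[OF assms] by (simp_all add: are_inverse_def)

lemma inv_arr_Comp_Comp:
  assumes "iso_arr C f" "h \<in> Arr C"
  shows "Cod C h = Dom C f \<Longrightarrow> inv_arr C f \<cdot> (f \<cdot> h) = h"
    "Cod C h = Cod C f \<Longrightarrow> f \<cdot> (inv_arr C f \<cdot> h) = h"
proof -
  have f: "f \<in> Arr C" using inv_arr_are_inverse[OF assms(1)] by (simp add: are_inverse_def)
  show "Cod C h = Dom C f \<Longrightarrow> inv_arr C f \<cdot> (f \<cdot> h) = h"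
    using f assms Comp_assoc_Arr[of h f "inv_arr C f"] by (simp add: inv_arr_typing inv_arr_Comp)
  show "Cod C h = Cod C f \<Longrightarrow> f \<cdot> (inv_arr C f \<cdot> h) = h"
    using f assms Comp_assoc_Arr[of h "inv_arr C f" f] by (simp add: inv_arr_typing inv_arr_Comp)
qed

lemma iso_arr_Arr: "iso_arr C f \<Longrightarrow> f \<in> Arr C"
  by (auto simp: iso_arr_def are_inverse_def)

lemma iso_cancel_right:
  assumes f: "iso_arr C f" and "g \<in> Arr C" "h \<in> Arr C" "Dom C g = Cod C f" "Dom C h = Cod C f"
    and eq: "g \<cdot> f = h \<cdot> f"
  shows "g = h"
proof -
  note [simp] = inv_arr_typing[OF f] inv_arr_Comp[OF f] iso_arr_Arr[OF f]
  have "g = (g \<cdot> f) \<cdot> inv_arr C f" using assms(2-5) by simp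
  also have "\<dots> = h" unfolding eq using assms(2-5) by simp
  finally show ?thesis .
qed

lemma iso_cancel_left:
  assumes f: "iso_arr C f" and "g \<in> Arr C" "h \<in> Arr C" "Cod C g = Dom C f" "Cod C h = Dom C f"
    and eq: "f \<cdot> g = f \<cdot> h"
  shows "g = h"
proof -
  note [simp] = inv_arr_typing[OF f] inv_arr_Comp[OF f] iso_arr_Arr[OF f]
  have "g = inv_arr C f \<cdot> (f \<cdot> g)" using assms(2-5) by (simp add: inv_arr_Comp_Comp[OF f])
  also have "\<dots> = h" unfolding eq using assms(2-5) by (simp add: inv_arr_Comp_Comp[OF f])
  finally show ?thesis .
qed

lemma iso_arr_Comp:
  assumes f: "iso_arr C f" and g: "iso_arr C g" and "Cod C f = Dom C g"
  shows "iso_arr C (g \<cdot> f)"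
proof -
  note [simp] = inv_arr_typing[OF f] inv_arr_Comp[OF f] iso_arr_Arr[OF f]
    inv_arr_typing[OF g] inv_arr_Comp[OF g] iso_arr_Arr[OF g] assms(3)
  have "are_inverse C (g \<cdot> f) (inv_arr C f \<cdot> inv_arr C g)"
    by (simp add: are_inverse_def hom_def inv_arr_Comp_Comp[OF f] inv_arr_Comp_Comp[OF g])
  then show ?thesis unfolding iso_arr_def ..
qed

end

section \<open>Coherence for the left unit\<close>

context monoidal_category
begin

lemma TensA_typing [simp]:
  assumes "f \<in> Arr V" "g \<in> Arr V"
  shows "f \<odot> g \<in> Arr V" "Dom V (f \<odot> g) = Dom V f \<otimes> Dom V g" "Cod V (f \<odot> g) = Cod V f \<otimes> Cod V g"
proof -
  have "f \<odot> g \<in> hom V (Dom V f \<otimes> Dom V g) (Cod V f \<otimes> Cod V g)"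
    using TensA_hom[OF homI homI] assms by simp
  then show "f \<odot> g \<in> Arr V" "Dom V (f \<odot> g) = Dom V f \<otimes> Dom V g" "Cod V (f \<odot> g) = Cod V f \<otimes> Cod V g"
    by (simp_all add: hom_def)
qed

lemmas [simp] = Unit_Obj TensO_Obj Dom_Obj Cod_Obj TensA_Idt

lemma structure_typing [simp]:
  assumes X: "X \<in> Obj V"
  shows "Lunit V X \<in> Arr V" "Dom V (Lunit V X) = \<I> \<otimes> X" "Cod V (Lunit V X) = X"
    and "Runit V X \<in> Arr V" "Dom V (Runit V X) = X \<otimes> \<I>" "Cod V (Runit V X) = X"
    and "\<lbrakk>Y \<in> Obj V; Z \<in> Obj V\<rbrakk> \<Longrightarrow> Assoc V X Y Z \<in> Arr V"
    and "\<lbrakk>Y \<in> Obj V; Z \<in> Obj V\<rbrakk> \<Longrightarrow> Dom V (Assoc V X Y Z) = (X \<otimes> Y) \<otimes> Z"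
    and "\<lbrakk>Y \<in> Obj V; Z \<in> Obj V\<rbrakk> \<Longrightarrow> Cod V (Assoc V X Y Z) = X \<otimes> (Y \<otimes> Z)"
  using homD[OF Lunit_hom[OF X]] homD[OF Runit_hom[OF X]] homD[OF Assoc_hom[OF X]] by simp_all

lemma structure_inv [simp]:
  assumes X: "X \<in> Obj V"
  shows "inv_arr V (Lunit V X) \<in> Arr V"
    "Dom V (inv_arr V (Lunit V X)) = X" "Cod V (inv_arr V (Lunit V X)) = \<I> \<otimes> X"
    "inv_arr V (Lunit V X) \<cdot> Lunit V X = \<one> (\<I> \<otimes> X)" "Lunit V X \<cdot> inv_arr V (Lunit V X) = \<one> X"
    and "inv_arr V (Runit V X) \<in> Arr V"
    "Dom V (inv_arr V (Runit V X)) = X" "Cod V (inv_arr V (Runit V X)) = X \<otimes> \<I>"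
    "inv_arr V (Runit V X) \<cdot> Runit V X = \<one> (X \<otimes> \<I>)" "Runit V X \<cdot> inv_arr V (Runit V X) = \<one> X"
  using inv_arr_typing[OF Lunit_iso[OF X]] inv_arr_Comp[OF Lunit_iso[OF X]]
    inv_arr_typing[OF Runit_iso[OF X]] inv_arr_Comp[OF Runit_iso[OF X]] X by simp_all

lemma interchange:
  assumes "f \<in> Arr V" "f' \<in> Arr V" "g \<in> Arr V" "g' \<in> Arr V" "Cod V f = Dom V f'" "Cod V g = Dom V g'"
  shows "(f' \<odot> g') \<cdot> (f \<odot> g) = (f' \<cdot> f) \<odot> (g' \<cdot> g)"
  using TensA_Comp[OF homI homI homI homI] assms by simp

lemma iso_TensA_Idt:
  assumes f: "iso_arr V f" and "X \<in> Obj V"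
  shows "iso_arr V (f \<odot> \<one> X)"
proof -
  note [simp] = inv_arr_typing[OF f] inv_arr_Comp[OF f] iso_arr_Arr[OF f] assms(2)
  have "are_inverse V (f \<odot> \<one> X) (inv_arr V f \<odot> \<one> X)"
    by (simp add: are_inverse_def hom_def interchange)
  then show ?thesis unfolding iso_arr_def ..
qed

text \<open>
  The left unit constraint is a natural isomorphism from \<open>I \<otimes> _\<close> to the identity functor.
\<close>

lemma Unit_TensA_faithful:
  assumes "f \<in> hom V X Y" "g \<in> hom V X Y" and eq: "\<one> \<I> \<odot> f = \<one> \<I> \<odot> g"
  shows "f = g"
proof (rule iso_cancel_right)
  show "iso_arr V (Lunit V X)" using assms(1) hom_Obj Lunit_iso by blast
  show "f \<cdot> Lunit V X = g \<cdot> Lunit V X"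
    using Lunit_natural[OF assms(1)] Lunit_natural[OF assms(2)] eq by simp
qed (use assms(1,2) hom_Obj in \<open>auto simp: homD\<close>)

text \<open>
  Kelly's argument: by faithfulness of \<open>I \<otimes> _\<close> the equation may be proved after tensoring with \<open>I\<close>.
  Composed with the invertible path from \<open>((I \<otimes> I) \<otimes> Y) \<otimes> Z\<close> to \<open>I \<otimes> ((I \<otimes> Y) \<otimes> Z)\<close>, both sides
  then equal the arrow that removes the second \<open>I\<close> by the right unit constraint: one side by the
  pentagon and the triangle for \<open>Y \<otimes> Z\<close>, the other by the triangle for \<open>Y\<close>.
\<close>

lemma Lunit_TensO:
  assumes Y [simp]: "Y \<in> Obj V" and Z [simp]: "Z \<in> Obj V"
  shows "Lunit V (Y \<otimes> Z) \<cdot> Assoc V \<I> Y Z = Lunit V Y \<odot> \<one> Z"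
proof (rule Unit_TensA_faithful)
  let ?a = "Assoc V \<I> (\<I> \<otimes> Y) Z \<cdot> (Assoc V \<I> \<I> Y \<odot> \<one> Z)"
  have iso: "iso_arr V ?a"
    by (intro iso_arr_Comp iso_TensA_Idt Assoc_iso) simp_all
  have "(\<one> \<I> \<odot> (Lunit V (Y \<otimes> Z) \<cdot> Assoc V \<I> Y Z)) \<cdot> ?a
      = (\<one> \<I> \<odot> Lunit V (Y \<otimes> Z)) \<cdot> ((\<one> \<I> \<odot> Assoc V \<I> Y Z) \<cdot> ?a)"
    by (simp add: interchange flip: Comp_assoc_Arr)
  also have "\<dots> = ((\<one> \<I> \<odot> Lunit V (Y \<otimes> Z)) \<cdot> Assoc V \<I> \<I> (Y \<otimes> Z)) \<cdot> Assoc V (\<I> \<otimes> \<I>) Y Z"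
    by (simp add: pentagon)
  also have "\<dots> = (Runit V \<I> \<odot> (\<one> Y \<odot> \<one> Z)) \<cdot> Assoc V (\<I> \<otimes> \<I>) Y Z"
    by (simp add: triangle del: Comp_assoc_Arr)
  also have "\<dots> = Assoc V \<I> Y Z \<cdot> ((Runit V \<I> \<odot> \<one> Y) \<odot> \<one> Z)"
    by (rule Assoc_natural[symmetric]) (simp_all add: hom_def)
  also have "\<dots> = Assoc V \<I> Y Z \<cdot> (((\<one> \<I> \<odot> Lunit V Y) \<odot> \<one> Z) \<cdot> (Assoc V \<I> \<I> Y \<odot> \<one> Z))"
    by (simp add: interchange triangle)
  also have "\<dots> = (Assoc V \<I> Y Z \<cdot> ((\<one> \<I> \<odot> Lunit V Y) \<odot> \<one> Z)) \<cdot> (Assoc V \<I> \<I> Y \<odot> \<one> Z)"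
    by simp
  also have "Assoc V \<I> Y Z \<cdot> ((\<one> \<I> \<odot> Lunit V Y) \<odot> \<one> Z)
      = (\<one> \<I> \<odot> (Lunit V Y \<odot> \<one> Z)) \<cdot> Assoc V \<I> (\<I> \<otimes> Y) Z"
    by (rule Assoc_natural) (simp_all add: hom_def)
  also have "\<dots> \<cdot> (Assoc V \<I> \<I> Y \<odot> \<one> Z) = (\<one> \<I> \<odot> (Lunit V Y \<odot> \<one> Z)) \<cdot> ?a"
    by simp
  finally show "\<one> \<I> \<odot> (Lunit V (Y \<otimes> Z) \<cdot> Assoc V \<I> Y Z) = \<one> \<I> \<odot> (Lunit V Y \<odot> \<one> Z)"
    by (rule iso_cancel_right[OF iso, rotated -1]) simp_all
qed (simp_all add: hom_def)

lemma Assoc_inv_Lunit: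
  assumes [simp]: "Y \<in> Obj V" "Z \<in> Obj V"
  shows "Assoc V \<I> Y Z \<cdot> (inv_arr V (Lunit V Y) \<odot> \<one> Z) = inv_arr V (Lunit V (Y \<otimes> Z))"
proof (rule iso_cancel_left[OF Lunit_iso[of "Y \<otimes> Z"]])
  have "Lunit V (Y \<otimes> Z) \<cdot> (Assoc V \<I> Y Z \<cdot> (inv_arr V (Lunit V Y) \<odot> \<one> Z))
      = (Lunit V (Y \<otimes> Z) \<cdot> Assoc V \<I> Y Z) \<cdot> (inv_arr V (Lunit V Y) \<odot> \<one> Z)"
    by simp
  also have "\<dots> = Lunit V (Y \<otimes> Z) \<cdot> inv_arr V (Lunit V (Y \<otimes> Z))"
    unfolding Lunit_TensO[OF assms] by (simp add: interchange)
  finally show "Lunit V (Y \<otimes> Z) \<cdot> (Assoc V \<I> Y Z \<cdot> (inv_arr V (Lunit V Y) \<odot> \<one> Z)) = \<dots>" .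
qed simp_all

lemma Assoc_inv_Runit:
  assumes [simp]: "Y \<in> Obj V" "Z \<in> Obj V"
  shows "Assoc V Y \<I> Z \<cdot> (inv_arr V (Runit V Y) \<odot> \<one> Z) = \<one> Y \<odot> inv_arr V (Lunit V Z)"
proof -
  let ?l = "\<one> Y \<odot> inv_arr V (Lunit V Z)" and ?r = "inv_arr V (Runit V Y) \<odot> \<one> Z"
  have "Assoc V Y \<I> Z \<cdot> ?r = (?l \<cdot> (\<one> Y \<odot> Lunit V Z)) \<cdot> (Assoc V Y \<I> Z \<cdot> ?r)"
    by (simp add: interchange)
  also have "\<dots> = ?l \<cdot> (((\<one> Y \<odot> Lunit V Z) \<cdot> Assoc V Y \<I> Z) \<cdot> ?r)"
    by simp
  also have "\<dots> = ?l"
    unfolding triangle[OF assms] by (simp add: interchange)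
  finally show ?thesis .
qed

lemma inv_Lunit_natural:
  assumes f: "f \<in> Arr V"
  shows "(\<one> \<I> \<odot> f) \<cdot> inv_arr V (Lunit V (Dom V f)) = inv_arr V (Lunit V (Cod V f)) \<cdot> f"
proof (rule iso_cancel_left[OF Lunit_iso[of "Cod V f"]])
  have "Lunit V (Cod V f) \<cdot> ((\<one> \<I> \<odot> f) \<cdot> inv_arr V (Lunit V (Dom V f)))
      = (f \<cdot> Lunit V (Dom V f)) \<cdot> inv_arr V (Lunit V (Dom V f))"
    using f by (simp flip: Lunit_natural[OF homI[OF f refl refl]])
  also have "\<dots> = f" using f by simp
  also have "\<dots> = Lunit V (Cod V f) \<cdot> (inv_arr V (Lunit V (Cod V f)) \<cdot> f)"
    using f by (simp add: inv_arr_Comp_Comp[OF Lunit_iso])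
  finally show "Lunit V (Cod V f) \<cdot> ((\<one> \<I> \<odot> f) \<cdot> inv_arr V (Lunit V (Dom V f))) = \<dots>" .
qed (use f in simp_all)

end

section \<open>Composition in the self-enrichment\<close>

context closed_symmetric_monoidal_category
begin

lemma IHom_Eval_typing [simp]:
  assumes "X \<in> Obj V" "Y \<in> Obj V"
  shows "IHom V X Y \<in> Obj V" "Eval V X Y \<in> Arr V"
    "Dom V (Eval V X Y) = IHom V X Y \<otimes> X" "Cod V (Eval V X Y) = Y"
  using IHom_Obj homD[OF Eval_hom] assms by simp_all

lemma curry_arr_props:
  assumes "X \<in> Obj V" "Z \<in> Obj V" "f \<in> hom V (Z \<otimes> X) Y"
  shows "curry_arr V Z X Y f \<in> hom V Z (IHom V X Y)"
    "Eval V X Y \<cdot> (curry_arr V Z X Y f \<odot> \<one> X) = f"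
proof -
  have "Y \<in> Obj V" using assms(3) hom_Obj by blast
  from theI'[OF closed[OF assms(1) this assms(2,3)]]
  show "curry_arr V Z X Y f \<in> hom V Z (IHom V X Y)"
    "Eval V X Y \<cdot> (curry_arr V Z X Y f \<odot> \<one> X) = f"
    unfolding curry_arr_def by simp_all
qed

lemma underlying_arr_hom:
  assumes "X \<in> Obj V" "Y \<in> Obj V" "a \<in> hom V \<I> (IHom V X Y)"
  shows "underlying_arr V X Y a \<in> hom V X Y"
  using assms by (simp add: underlying_arr_def hom_def)

lemma EComp_self_enriched_hom:
  assumes [simp]: "X \<in> Obj V" "Y \<in> Obj V" "Z \<in> Obj V"
  shows "EComp (self_enriched V) X Y Z \<in> hom V (IHom V Y Z \<otimes> IHom V X Y) (IHom V X Z)"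
  unfolding self_enriched_def by (simp, rule curry_arr_props) (simp_all add: hom_def)

lemma Eval_EComp:
  assumes [simp]: "X \<in> Obj V" "Y \<in> Obj V" "Z \<in> Obj V"
    and a: "a \<in> hom V A (IHom V X Y)" and b: "b \<in> hom V B (IHom V Y Z)"
  shows "Eval V X Z \<cdot> ((EComp (self_enriched V) X Y Z \<cdot> (b \<odot> a)) \<odot> \<one> X)
    = Eval V Y Z \<cdot> ((b \<odot> (Eval V X Y \<cdot> (a \<odot> \<one> X))) \<cdot> Assoc V B A X)"
proof -
  note [simp] = homD[OF a] homD[OF b] hom_Obj[OF a] hom_Obj[OF b]
  let ?BC = "IHom V Y Z" and ?AB = "IHom V X Y"
  let ?c = "EComp (self_enriched V) X Y Z"
  have f: "Eval V Y Z \<cdot> ((\<one> ?BC \<odot> Eval V X Y) \<cdot> Assoc V ?BC ?AB X) \<in> hom V ((?BC \<otimes> ?AB) \<otimes> X) Z"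
    by (simp add: hom_def)
  have ev: "Eval V X Z \<cdot> (?c \<odot> \<one> X) = Eval V Y Z \<cdot> ((\<one> ?BC \<odot> Eval V X Y) \<cdot> Assoc V ?BC ?AB X)"
    by (simp add: self_enriched_def curry_arr_props(2)[OF _ _ f])
  note [simp] = homD[OF EComp_self_enriched_hom]
  have "Eval V X Z \<cdot> ((?c \<cdot> (b \<odot> a)) \<odot> \<one> X) = (Eval V X Z \<cdot> (?c \<odot> \<one> X)) \<cdot> ((b \<odot> a) \<odot> \<one> X)"
    by (simp add: interchange)
  also have "\<dots> = Eval V Y Z \<cdot> ((\<one> ?BC \<odot> Eval V X Y) \<cdot> (Assoc V ?BC ?AB X \<cdot> ((b \<odot> a) \<odot> \<one> X)))"
    unfolding ev by simp
  also have "Assoc V ?BC ?AB X \<cdot> ((b \<odot> a) \<odot> \<one> X) = (b \<odot> (a \<odot> \<one> X)) \<cdot> Assoc V B A X"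
    by (rule Assoc_natural) (simp_all add: hom_def)
  also have "(\<one> ?BC \<odot> Eval V X Y) \<cdot> \<dots> = ((\<one> ?BC \<odot> Eval V X Y) \<cdot> (b \<odot> (a \<odot> \<one> X))) \<cdot> Assoc V B A X"
    by simp
  also have "\<dots> = (b \<odot> (Eval V X Y \<cdot> (a \<odot> \<one> X))) \<cdot> Assoc V B A X"
    by (simp add: interchange)
  finally show ?thesis .
qed

text \<open>
  The arrow on the left, built from \<open>b\<close> with enriched composition and the inverse unit constraint, is
  one side of the enriched naturality square. Evaluating it moves \<open>b\<close> past the argument object \<open>X\<close>,
  which is where the coherence of the left unit constraint enters.
\<close>

lemma Eval_post_composition:
  assumes [simp]: "X \<in> Obj V" "Y \<in> Obj V" "Z \<in> Obj V"
    and a: "a \<in> hom V A (IHom V X Y)" and b: "b \<in> hom V \<I> (IHom V Y Z)"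
  shows "Eval V X Z \<cdot> ((EComp (self_enriched V) X Y Z \<cdot> ((b \<odot> a) \<cdot> inv_arr V (Lunit V A))) \<odot> \<one> X)
    = underlying_arr V Y Z b \<cdot> (Eval V X Y \<cdot> (a \<odot> \<one> X))"
proof -
  note [simp] = homD[OF a] homD[OF b] hom_Obj[OF a] homD[OF EComp_self_enriched_hom]
  let ?c = "EComp (self_enriched V) X Y Z" and ?e = "Eval V X Y \<cdot> (a \<odot> \<one> X)"
  have "Eval V X Z \<cdot> ((?c \<cdot> ((b \<odot> a) \<cdot> inv_arr V (Lunit V A))) \<odot> \<one> X)
      = (Eval V X Z \<cdot> ((?c \<cdot> (b \<odot> a)) \<odot> \<one> X)) \<cdot> (inv_arr V (Lunit V A) \<odot> \<one> X)"
    by (simp add: interchange)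
  also have "\<dots> = Eval V Y Z \<cdot> ((b \<odot> ?e) \<cdot> (Assoc V \<I> A X \<cdot> (inv_arr V (Lunit V A) \<odot> \<one> X)))"
    unfolding Eval_EComp[OF assms] by simp
  also have "\<dots> = Eval V Y Z \<cdot> (((b \<odot> \<one> Y) \<cdot> (\<one> \<I> \<odot> ?e)) \<cdot> inv_arr V (Lunit V (A \<otimes> X)))"
    by (simp add: Assoc_inv_Lunit interchange)
  also have "\<dots> = Eval V Y Z \<cdot> ((b \<odot> \<one> Y) \<cdot> ((\<one> \<I> \<odot> ?e) \<cdot> inv_arr V (Lunit V (Dom V ?e))))"
    by simp
  also have "\<dots> = underlying_arr V Y Z b \<cdot> ?e"
    by (subst inv_Lunit_natural) (simp_all add: underlying_arr_def)
  finally show ?thesis .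
qed

text \<open>
  The counterpart for the other side of the naturality square; here the triangle axiom suffices.
\<close>

lemma Eval_pre_composition:
  assumes [simp]: "X \<in> Obj V" "Y \<in> Obj V" "Z \<in> Obj V"
    and a: "a \<in> hom V \<I> (IHom V X Y)" and b: "b \<in> hom V B (IHom V Y Z)"
  shows "Eval V X Z \<cdot> ((EComp (self_enriched V) X Y Z \<cdot> ((b \<odot> a) \<cdot> inv_arr V (Runit V B))) \<odot> \<one> X)
    = Eval V Y Z \<cdot> (b \<odot> underlying_arr V X Y a)"
proof -
  note [simp] = homD[OF a] homD[OF b] hom_Obj[OF b] homD[OF EComp_self_enriched_hom]
  let ?c = "EComp (self_enriched V) X Y Z" and ?e = "Eval V X Y \<cdot> (a \<odot> \<one> X)"
  have "Eval V X Z \<cdot> ((?c \<cdot> ((b \<odot> a) \<cdot> inv_arr V (Runit V B))) \<odot> \<one> X)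
      = (Eval V X Z \<cdot> ((?c \<cdot> (b \<odot> a)) \<odot> \<one> X)) \<cdot> (inv_arr V (Runit V B) \<odot> \<one> X)"
    by (simp add: interchange)
  also have "\<dots> = Eval V Y Z \<cdot> ((b \<odot> ?e) \<cdot> (Assoc V B \<I> X \<cdot> (inv_arr V (Runit V B) \<odot> \<one> X)))"
    unfolding Eval_EComp[OF assms] by simp
  also have "\<dots> = Eval V Y Z \<cdot> (b \<odot> underlying_arr V X Y a)"
    by (simp add: Assoc_inv_Runit interchange underlying_arr_def)
  finally show ?thesis .
qed

text \<open>
  In elements: \<open>q\<^sub>Y ((Q f) x) = f (q\<^sub>X x)\<close> for \<open>f\<close> in \<open>[X, Y]\<close> and \<open>x\<close> in \<open>Q X\<close>. Both sides are the
  evaluations of the two paths in the enriched naturality square.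
\<close>

lemma uncurried_naturality:
  assumes "enriched_natural_transformation V (self_enriched V) (self_enriched V)
      Qo Qh (\<lambda>X. X) (\<lambda>X Y. \<one> (IHom V X Y)) q"
    and [simp]: "X \<in> Obj V" "Y \<in> Obj V"
  shows "underlying_arr V (Qo Y) Y (q Y) \<cdot> (Eval V (Qo X) (Qo Y) \<cdot> (Qh X Y \<odot> \<one> (Qo X)))
    = Eval V X Y \<cdot> (\<one> (IHom V X Y) \<odot> underlying_arr V (Qo X) X (q X))"
proof -
  interpret q: enriched_natural_transformation V "self_enriched V" "self_enriched V"
    Qo Qh "\<lambda>X. X" "\<lambda>X Y. \<one> (IHom V X Y)" q by fact
  have self: "EObj (self_enriched V) = Obj V" "EHom (self_enriched V) = IHom V"
    by (simp_all add: self_enriched_def)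
  note [simp] = q.F.Fo_EObj[unfolded self]
  note Qh = q.F.Fh_hom[unfolded self, OF assms(2,3)] and q_hom = q.component_hom[unfolded self]
  show ?thesis
    using Eval_post_composition[OF _ _ _ Qh q_hom[OF assms(3)]]
      Eval_pre_composition[OF _ _ _ q_hom[OF assms(2)] Idt_hom[of "IHom V X Y"]]
      q.natural[unfolded self, OF assms(2,3)]
    by simp
qed

text \<open>
  With \<open>u : X \<rightarrow> [I, X]\<close> the canonical arrow, the section is \<open>x \<mapsto> (Q (u x)) s\<close>, and naturality
  gives \<open>q\<^sub>X ((Q (u x)) s) = (u x) (q\<^sub>I s) = x\<close>.
\<close>

lemma section_from_unit:
  assumes q: "enriched_natural_transformation V (self_enriched V) (self_enriched V)
      Qo Qh (\<lambda>X. X) (\<lambda>X Y. \<one> (IHom V X Y)) q"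
    and s: "s \<in> hom V \<I> (Qo \<I>)" and s_section: "underlying_arr V (Qo \<I>) \<I> (q \<I>) \<cdot> s = \<one> \<I>"
    and X [simp]: "X \<in> Obj V"
  shows "\<exists>r \<in> hom V X (Qo X). underlying_arr V (Qo X) X (q X) \<cdot> r = \<one> X"
proof -
  interpret q: enriched_natural_transformation V "self_enriched V" "self_enriched V"
    Qo Qh "\<lambda>X. X" "\<lambda>X Y. \<one> (IHom V X Y)" q by fact
  have self: "EObj (self_enriched V) = Obj V" "EHom (self_enriched V) = IHom V"
    by (simp_all add: self_enriched_def)
  note [simp] = q.F.Fo_EObj[unfolded self] homD[OF s]
    homD[OF q.F.Fh_hom[unfolded self, OF Unit_Obj X]]
    homD[OF underlying_arr_hom[OF _ _ q.component_hom[unfolded self]]]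
  define u where "u = curry_arr V X \<I> X (Runit V X)"
  have u: "u \<in> hom V X (IHom V \<I> X)" and ev_u: "Eval V \<I> X \<cdot> (u \<odot> \<one> \<I>) = Runit V X"
    unfolding u_def using curry_arr_props[OF _ _ Runit_hom] by simp_all
  note [simp] = homD[OF u]
  let ?p = "\<lambda>Y. underlying_arr V (Qo Y) Y (q Y)"
  let ?e = "Eval V (Qo \<I>) (Qo X)"
  define r where "r = (?e \<cdot> ((Qh \<I> X \<cdot> u) \<odot> s)) \<cdot> inv_arr V (Runit V X)"
  have "?p X \<cdot> r = ?p X \<cdot> (?e \<cdot> (((Qh \<I> X \<odot> \<one> (Qo \<I>)) \<cdot> (u \<odot> s)) \<cdot> inv_arr V (Runit V X)))"
    by (simp add: r_def interchange)
  also have "\<dots> = (?p X \<cdot> (?e \<cdot> (Qh \<I> X \<odot> \<one> (Qo \<I>)))) \<cdot> ((u \<odot> s) \<cdot> inv_arr V (Runit V X))"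
    by simp
  also have "\<dots> = Eval V \<I> X \<cdot> (((\<one> (IHom V \<I> X) \<odot> ?p \<I>) \<cdot> (u \<odot> s)) \<cdot> inv_arr V (Runit V X))"
    unfolding uncurried_naturality[OF q Unit_Obj X] by simp
  also have "\<dots> = (Eval V \<I> X \<cdot> (u \<odot> \<one> \<I>)) \<cdot> inv_arr V (Runit V X)"
    by (simp add: interchange s_section)
  also have "\<dots> = \<one> X"
    by (simp add: ev_u)
  finally have "?p X \<cdot> r = \<one> X" .
  moreover have "r \<in> hom V X (Qo X)" by (simp add: r_def hom_def)
  ultimately show ?thesis by blast
qed

end

section \<open>Cofibrant objects\<close>

context model_category
begin

text \<open>
  The section is a lift of the identity of \<open>X\<close> against \<open>p\<close>; the required square commutes because its
  upper left corner is initial.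
\<close>

lemma cofibrant_trivial_Fib_section:
  assumes "cofibrant C M X" and p: "p \<in> hom C Y X" "p \<in> Fib M \<inter> Weq M"
  shows "\<exists>s \<in> hom C X Y. p \<cdot> s = \<one> X"
proof -
  obtain Z i where Z: "is_initial C Z" and i: "i \<in> hom C Z X" "i \<in> Cof M"
    using assms(1) by (auto simp: cofibrant_def)
  obtain z where z: "z \<in> hom C Z Y" using Z hom_Obj[OF p(1)] by (auto simp: is_initial_def)
  have "p \<cdot> z = i"
    using Z Comp_hom[OF z p(1)] i(1) hom_Obj[OF p(1)] by (auto simp: is_initial_def)
  also have "\<dots> = \<one> X \<cdot> i" using Comp_Idt_left[OF i(1)] by simp
  finally show ?thesis
    using lifting_Cof[OF i(2) p(2)] z homD[OF i(1)] homD[OF p(1)] Idt_hom hom_Obj[OF p(1)]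
    unfolding has_lifting_def by metis
qed

text \<open>
  The arrow from the initial object to \<open>X\<close> is a retract of the one to \<open>Y\<close>, with an identity on
  domains.
\<close>

lemma cofibrant_retract:
  assumes "cofibrant C M Y" and s: "s \<in> hom C X Y" and p: "p \<in> hom C Y X" and ps: "p \<cdot> s = \<one> X"
  shows "cofibrant C M X"
proof -
  obtain Z i where Z: "is_initial C Z" and i: "i \<in> hom C Z Y" "i \<in> Cof M"
    using assms(1) by (auto simp: cofibrant_def)
  have pi: "p \<cdot> i \<in> hom C Z X" using Comp_hom[OF i(1) p] .
  have spi: "s \<cdot> (p \<cdot> i) = i"
    using Z Comp_hom[OF pi s] i(1) hom_Obj[OF s] by (auto simp: is_initial_def)
  have Z1: "\<one> Z \<in> hom C Z Z" using Z Idt_hom by (simp add: is_initial_def)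
  have "is_retract C (p \<cdot> i) i"
    unfolding is_retract_def homD[OF i(1)] homD[OF pi]
    using Z1 s p ps spi homD(1)[OF i(1)] homD(1)[OF pi]
      Comp_Idt_right[OF i(1)] Comp_Idt_right[OF pi] Comp_Idt_right[OF Z1]
    by (intro conjI bexI[of _ "\<one> Z"] bexI[of _ s] bexI[of _ p]) simp_all
  then have "p \<cdot> i \<in> Cof M" using Cof_retract i(2) by blast
  then show ?thesis using Z pi hom_Obj[OF s] by (auto simp: cofibrant_def)
qed

end

theorem propositionA1:
  fixes V :: "('o, 'm, 'z) csmcat_scheme"
    and \<kappa> :: "'s rel"
    and M :: "'m model_structure"
    and Qo :: "'o \<Rightarrow> 'o" and Qh :: "'o \<Rightarrow> 'o \<Rightarrow> 'm" and q :: "'o \<Rightarrow> 'm"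
  assumes "monoidal_model_category V \<kappa> M"
    and "cofibrant V M (Unit V)"
    and "enriched_functor V (self_enriched V) (self_enriched V) Qo Qh"
    and "enriched_natural_transformation V (self_enriched V) (self_enriched V)
           Qo Qh (\<lambda>X. X) (\<lambda>X Y. Idt V (IHom V X Y)) q"
    and "\<forall>X \<in> Obj V. cofibrant V M (Qo X)"
    and "\<forall>X \<in> Obj V. underlying_arr V (Qo X) X (q X) \<in> Fib M \<inter> Weq M"
  shows "\<forall>X \<in> Obj V. cofibrant V M X"
proof
  fix X assume X: "X \<in> Obj V"
  interpret monoidal_model_category V \<kappa> M by fact
  interpret q: enriched_natural_transformation V "self_enriched V" "self_enriched V"
    Qo Qh "\<lambda>X. X" "\<lambda>X Y. Idt V (IHom V X Y)" q by fact
  let ?p = "\<lambda>Y. underlying_arr V (Qo Y) Y (q Y)"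
  have p: "?p Y \<in> hom V (Qo Y) Y" if "Y \<in> Obj V" for Y
    using underlying_arr_hom[of "Qo Y" Y "q Y"] q.component_hom[of Y] q.F.Fo_EObj[of Y] that
    by (simp add: self_enriched_def)
  obtain s where "s \<in> hom V (Unit V) (Qo (Unit V))" "?p (Unit V) \<cdot>\<^bsub>V\<^esub> s = Idt V (Unit V)"
    using cofibrant_trivial_Fib_section[OF assms(2) p] assms(6) Unit_Obj by blast
  then obtain r where "r \<in> hom V X (Qo X)" "?p X \<cdot>\<^bsub>V\<^esub> r = Idt V X"
    using section_from_unit[OF assms(4) _ _ X] by blast
  then show "cofibrant V M X"
    using cofibrant_retract p[OF X] assms(5) X by blast
qed

end
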